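(* There is a polynomial time $\frac{e-1}{e+1}$-approximation algorithm for Max Ext-Representation under the Non-Secrecy Setting.
   Context: Election setting: a set of voters $X = \{v_1,\dots,v_n\}$ and a set of candidates $Z = \{c_1,\dots,c_m\}$; each voter $v_i$ approves of a set $vote_i \subseteq Z$ (given as input), and $S_j \subseteq X$ is the set of voters approving of $c_j$. In the Non-Secrecy Setting voter identities are known, so it is known which candidates are also voters. For a committee $C\subseteq Z$, $ext(C) = \left|\bigcup_{c_j\in C} S_j \setminus C\right|$ is the number of externally represented voters (voters approving of some committee member, excluding committee members themselves). Max Ext-Representation: given the votes and an integer $p$, find a committee $C \subseteq Z$ with $|C|=p$ maximizing $ext(C)$. *)

theory Defs
  imports Complex_Main "HOL-Computational_Algebra.Polynomial"
begin

text \<open>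
  Model of computation: structured programs for a random access machine, charged by the
  logarithmic cost criterion (every operation costs the bit lengths of the addresses and operands it
  handles).  There is no multiplication instruction.  Polynomial time on this machine is
  polynomial time on Turing machines.

  Register indices are constants of the program text, so a program uses finitely many registers;
  the memory is addressed indirectly through registers.
\<close>

type_synonym reg = nat

datatype prog =
    Skip
  | Const reg nat
  | Add reg reg reg
  | Sub reg reg reg
  | Load reg reg
  | Store reg reg
  | Seq prog prog
  | Cond reg prog prog
  | While reg prog

fun bit_length :: "nat \<Rightarrow> nat" where
  "bit_length n = (if n < 2 then 1 else Suc (bit_length (n div 2)))"

declare bit_length.simps [simp del]

type_synonym state = "(reg \<Rightarrow> nat) \<times> (nat \<Rightarrow> nat)"

text \<open>\<open>exec c s t s'\<close>: program \<open>c\<close> started in \<open>s\<close> halts in \<open>s'\<close> at total cost \<open>t\<close>.\<close>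

inductive exec :: "prog \<Rightarrow> state \<Rightarrow> nat \<Rightarrow> state \<Rightarrow> bool" where
  Skip: "exec Skip s 1 s"
| Const: "exec (Const r k) (R, M) (bit_length k) (R(r := k), M)"
| Add: "exec (Add r a b) (R, M) (bit_length (R a) + bit_length (R b)) (R(r := R a + R b), M)"
| Sub: "exec (Sub r a b) (R, M) (bit_length (R a) + bit_length (R b)) (R(r := R a - R b), M)"
| Load: "exec (Load r a) (R, M) (bit_length (R a) + bit_length (M (R a))) (R(r := M (R a)), M)"
| Store: "exec (Store a b) (R, M) (bit_length (R a) + bit_length (R b)) (R, M(R a := R b))"
| Seq: "exec c s t s' \<Longrightarrow> exec d s' t' s'' \<Longrightarrow> exec (Seq c d) s (t + t') s''"
| CondTrue: "R a \<noteq> 0 \<Longrightarrow> exec c (R, M) t s' \<Longrightarrow> exec (Cond a c d) (R, M) (bit_length (R a) + t) s'"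
| CondFalse: "R a = 0 \<Longrightarrow> exec d (R, M) t s' \<Longrightarrow> exec (Cond a c d) (R, M) (bit_length (R a) + t) s'"
| WhileFalse: "R a = 0 \<Longrightarrow> exec (While a c) (R, M) (bit_length (R a)) (R, M)"
| WhileTrue: "R a \<noteq> 0 \<Longrightarrow> exec c (R, M) t s' \<Longrightarrow> exec (While a c) s' t' s'' \<Longrightarrow>
    exec (While a c) (R, M) (bit_length (R a) + t + t') s''"

inductive_cases exec_elims:
  "exec Skip s t s'"
  "exec (Const r k) s t s'"
  "exec (Add r a b) s t s'"
  "exec (Sub r a b) s t s'"
  "exec (Load r a) s t s'"
  "exec (Store a b) s t s'"
  "exec (Seq c d) s t s'"
  "exec (Cond a c d) s t s'"
  "exec (While a c) s t s'"

lemma exec_deterministic: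
  "exec c s t s' \<Longrightarrow> exec c s u s'' \<Longrightarrow> t = u \<and> s' = s''"
proof (induction arbitrary: u s'' rule: exec.induct)
  case (Seq c s t s' d t' s2)
  from Seq.prems obtain t1 s1 t2 where 1: "exec c s t1 s1" and 2: "exec d s1 t2 s''"
    and u: "u = t1 + t2"
    by (rule exec_elims(7))
  from Seq.IH(1)[OF 1] Seq.IH(2)[of t2 s''] 2 u show ?case by simp
next
  case (CondTrue R a c M t s' d)
  from CondTrue.prems CondTrue.hyps obtain t1 where 1: "exec c (R, M) t1 s''"
    and u: "u = bit_length (R a) + t1"
    by (elim exec_elims(8)) simp_all
  from CondTrue.IH[OF 1] u show ?case by simp
next
  case (CondFalse R a d M t s' c)
  from CondFalse.prems CondFalse.hyps obtain t1 where 1: "exec d (R, M) t1 s''"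
    and u: "u = bit_length (R a) + t1"
    by (elim exec_elims(8)) simp_all
  from CondFalse.IH[OF 1] u show ?case by simp
next
  case (WhileFalse R a c M)
  from WhileFalse.prems show ?case by (rule exec_elims(9)) (use WhileFalse.hyps in auto)
next
  case (WhileTrue R a c M t s' t' s2)
  have "\<exists>t1 s1 t2. exec c (R, M) t1 s1 \<and> exec (While a c) s1 t2 s'' \<and>
      u = bit_length (R a) + t1 + t2"
    using WhileTrue.prems by (rule exec_elims(9)) (use WhileTrue.hyps in auto)
  then obtain t1 s1 t2 where 1: "exec c (R, M) t1 s1" and 2: "exec (While a c) s1 t2 s''"
    and u: "u = bit_length (R a) + t1 + t2"
    by blast
  from WhileTrue.IH(1)[OF 1] WhileTrue.IH(2)[of t2 s''] 2 u show ?case by simp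
qed (erule exec_elims(1) exec_elims(2) exec_elims(3) exec_elims(4) exec_elims(5) exec_elims(6); simp)+

text \<open>A word is presented in the initial cells of the memory, its number of entries in register 0;
  the output is read off in the same way.\<close>

definition input_state :: "nat list \<Rightarrow> state" where
  "input_state w = ((\<lambda>_. 0)(0 := length w), \<lambda>i. if i < length w then w ! i else 0)"

definition output_word :: "state \<Rightarrow> nat list" where
  "output_word s = map (snd s) [0..<fst s 0]"

definition input_size :: "nat list \<Rightarrow> nat" where
  "input_size w = (\<Sum>x\<leftarrow>w. bit_length x)"

record ('i, 's) max_problem =
  instances :: "'i set"
  encode :: "'i \<Rightarrow> nat list"
  decode :: "nat list \<Rightarrow> 's"
  feasible :: "'i \<Rightarrow> 's set"
  objective :: "'i \<Rightarrow> 's \<Rightarrow> nat"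

definition poly_time_approximation_algorithm ::
    "real \<Rightarrow> ('i, 's) max_problem \<Rightarrow> prog \<Rightarrow> bool" where
  "poly_time_approximation_algorithm \<alpha> P c \<longleftrightarrow>
    (\<exists>q :: nat poly. \<forall>I \<in> instances P. \<exists>t s.
       exec c (input_state (encode P I)) t s \<and>
       t \<le> poly q (input_size (encode P I)) \<and>
       decode P (output_word s) \<in> feasible P I \<and>
       (\<forall>C \<in> feasible P I.
          \<alpha> * real (objective P I C) \<le> real (objective P I (decode P (output_word s)))))"

text \<open>Persons are named by natural numbers.  In the non-secrecy setting a voter and a candidate are
  the same person iff they carry the same name, so \<open>voter_list\<close> and \<open>candidate_list\<close> may overlap.
  The \<open>i\<close>-th entry of \<open>vote_list\<close> lists the candidates approved of by the \<open>i\<close>-th voter.\<close>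

record election =
  voter_list :: "nat list"
  candidate_list :: "nat list"
  vote_list :: "nat list list"
  committee_size :: nat

definition valid_election :: "election \<Rightarrow> bool" where
  "valid_election E \<longleftrightarrow>
    distinct (voter_list E) \<and> distinct (candidate_list E) \<and>
    length (vote_list E) = length (voter_list E) \<and>
    (\<forall>vs \<in> set (vote_list E). distinct vs \<and> set vs \<subseteq> set (candidate_list E)) \<and>
    committee_size E \<le> length (candidate_list E)"

definition approvers :: "election \<Rightarrow> nat \<Rightarrow> nat set" where
  "approvers E c =
    {voter_list E ! i | i. i < length (voter_list E) \<and> c \<in> set (vote_list E ! i)}"

definition ext :: "election \<Rightarrow> nat set \<Rightarrow> nat" where
  "ext E C = card ((\<Union>c\<in>C. approvers E c) - C)"

definition committees :: "election \<Rightarrow> nat set set" where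
  "committees E = {C. C \<subseteq> set (candidate_list E) \<and> card C = committee_size E}"

definition encode_election :: "election \<Rightarrow> nat list" where
  "encode_election E =
    committee_size E # length (candidate_list E) # length (voter_list E) # candidate_list E @
    concat (map (\<lambda>(v, vs). v # length vs # vs) (zip (voter_list E) (vote_list E)))"

definition max_ext_representation :: "(election, nat set) max_problem" where
  "max_ext_representation =
    \<lparr>instances = Collect valid_election, encode = encode_election, decode = set,
     feasible = committees, objective = ext\<rparr>"

end

theory Submission
  imports Defs
begin

text \<open>
  The algorithm adds, \<open>p\<close> times, a candidate that maximises \<open>ext\<close> of the enlarged committee \<open>C\<close>; the
  gain may be negative. If at some point every gain is negative, then every remaining candidate is
  represented and represents nobody new, so every completion of \<open>C\<close> is optimal. Otherwise no step
  loses anything. If some step gains nothing, look at the first one, with \<open>|C| = i\<close>: then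
  \<open>ext C \<ge> i\<close>, and \<open>OPT - i \<le> ext C\<close> by submodularity, since \<open>C\<close> removes at most \<open>i\<close> voters
  from the optimum; so \<open>ext C \<ge> OPT / 2\<close>. If every step gains, the result \<open>C\<close> satisfies \<open>ext C \<ge> p\<close>, and the
  usual greedy recurrence gives \<open>OPT - ext C \<le> (OPT + p) / e \<le> (OPT + ext C) / e\<close>, which is the ratio
  \<open>(e - 1) / (e + 1)\<close>.
\<close>

section \<open>The greedy algorithm\<close>

definition nbh :: "('a \<Rightarrow> 'a set) \<Rightarrow> 'a set \<Rightarrow> 'a set" where
  "nbh S C = (\<Union>c\<in>C. S c)"

definition external :: "('a \<Rightarrow> 'a set) \<Rightarrow> 'a set \<Rightarrow> nat" where
  "external S C = card (nbh S C - C)"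

inductive greedy :: "('a set \<Rightarrow> nat) \<Rightarrow> 'a set \<Rightarrow> 'a set \<Rightarrow> bool" for f Z where
  empty: "greedy f Z {}"
| step: "greedy f Z C \<Longrightarrow> c \<in> Z - C \<Longrightarrow> (\<And>d. d \<in> Z - C \<Longrightarrow> f (insert d C) \<le> f (insert c C)) \<Longrightarrow>
    greedy f Z (insert c C)"

lemma greedy_finite: "greedy f Z C \<Longrightarrow> finite C"
  by (induction rule: greedy.induct) auto

lemma greedy_subset: "greedy f Z C \<Longrightarrow> C \<subseteq> Z"
  by (induction rule: greedy.induct) auto

definition saturated :: "('a \<Rightarrow> 'a set) \<Rightarrow> 'a set \<Rightarrow> 'a set \<Rightarrow> bool" where
  "saturated S Z C \<longleftrightarrow> (\<forall>c \<in> Z - C. c \<in> nbh S C \<and> S c \<subseteq> C \<union> nbh S C)"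

lemma finite_nbh: "finite C \<Longrightarrow> (\<And>c. finite (S c)) \<Longrightarrow> finite (nbh S C)"
  by (simp add: nbh_def)

lemma nbh_insert: "nbh S (insert d C) = S d \<union> nbh S C"
  by (simp add: nbh_def)

lemma saturated_insert: "saturated S Z C \<Longrightarrow> saturated S Z (insert c C)"
  by (auto simp: saturated_def nbh_insert)

text \<open>Passing from \<open>C\<close> to \<open>A\<close> can only expose voters in
  \<open>C - A\<close> or retain those in \<open>?N - A\<close>. The exposed ones are paid for by
  \<open>A - C\<close>, which has the same size and consists of voters that were external for
  \<open>C\<close>.\<close>

lemma saturated_imp_optimal:
  assumes "saturated S Z C" "A \<subseteq> Z" "card A = card C" "finite Z" "C \<subseteq> Z" "\<And>c. finite (S c)"
  shows "external S A \<le> external S C"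
proof -
  let ?N = "nbh S C - C"
  have fin: "finite C" "finite A" using assms finite_subset by blast+
  have finN: "finite ?N" using fin assms finite_nbh by blast
  have sub: "A - C \<subseteq> ?N \<inter> A"
    using assms(1,2) by (auto simp: saturated_def)
  have "nbh S A - A \<subseteq> (?N - A) \<union> (C - A)"
    using assms(1,2) by (fastforce simp: saturated_def nbh_def)
  then have "external S A \<le> card ((?N - A) \<union> (C - A))"
    unfolding external_def using finN fin by (intro card_mono) auto
  also have "\<dots> \<le> card (?N - A) + card (C - A)" by (rule card_Un_le)
  also have "card (C - A) = card (A - C)"
    using fin assms(3) card_Diff_subset_Int[of C A] card_Diff_subset_Int[of A C] by (simp add: Int_commute)
  also have "\<dots> \<le> card (?N \<inter> A)"
    using sub finN by (intro card_mono) auto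
  also have "card (?N - A) + card (?N \<inter> A) = card ?N"
    using finN by (metis add.commute card_Int_Diff)
  finally show ?thesis by (simp add: external_def)
qed

text \<open>The exact gain of \<open>d\<close>: its new voters, minus one if \<open>d\<close> was
  itself an external voter and now leaves the count. The loss stands on the left so that everything
  stays in the naturals.\<close>

lemma external_insert:
  assumes "finite C" "\<And>c. finite (S c)" "d \<notin> C"
  shows "external S (insert d C) + of_bool (d \<in> nbh S C) =
    external S C + card (S d - nbh S C - insert d C)"
proof -
  have fin: "finite (nbh S C)" "finite (S d)" using assms finite_nbh by blast+
  have "nbh S (insert d C) - insert d C = (nbh S C - C - {d}) \<union> (S d - nbh S C - insert d C)"
    by (auto simp: nbh_insert)
  then have "external S (insert d C) = card (nbh S C - C - {d}) + card (S d - nbh S C - insert d C)"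
    unfolding external_def using fin by (simp only:) (rule card_Un_disjoint, auto)
  moreover have "card (nbh S C - C - {d}) + of_bool (d \<in> nbh S C) = external S C"
  proof (cases "d \<in> nbh S C")
    case True
    then have "d \<in> nbh S C - C" using assms by simp
    then show ?thesis using True fin card_Suc_Diff1[of "nbh S C - C" d] by (simp add: external_def)
  next
    case False
    then show ?thesis by (simp add: external_def)
  qed
  ultimately show ?thesis by simp
qed

text \<open>A gain is never below -1, so a strictly negative one forces the loss of \<open>d\<close>
  and leaves no room for a single new voter.\<close>

lemma saturated_if_decreasing:
  assumes "finite C" "\<And>c. finite (S c)"
    and "\<And>d. d \<in> Z - C \<Longrightarrow> external S (insert d C) < external S C"
  shows "saturated S Z C"
  unfolding saturated_def
proof
  fix d assume d: "d \<in> Z - C"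
  have e: "external S (insert d C) + of_bool (d \<in> nbh S C) =
    external S C + card (S d - nbh S C - insert d C)"
    by (rule external_insert) (use assms d in auto)
  with assms(3)[OF d] have "d \<in> nbh S C" by (cases "d \<in> nbh S C") auto
  moreover from this e assms(3)[OF d] have "card (S d - nbh S C - insert d C) = 0" by simp
  then have "S d - nbh S C - insert d C = {}" using assms(2)[of d] by simp
  ultimately show "d \<in> nbh S C \<and> S d \<subseteq> C \<union> nbh S C" by auto
qed

text \<open>Submodularity adjusted for the removed members. A voter external to \<open>A\<close>
  lies in \<open>C\<close>, or is external to \<open>C\<close> and outside \<open>A\<close>, or is
  newly contributed by some \<open>d\<close> in \<open>A - C\<close>; a union bound does the rest.
  The losses of 1 in the gains add up to the card of \<open>?N \<inter> A\<close>, exactly what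
  \<open>?N - A\<close> is short of \<open>?N\<close>.\<close>

lemma external_le_gains:
  assumes "finite C" "finite A" "\<And>c. finite (S c)"
  shows "int (external S A) - int (card C) \<le>
    int (external S C) + (\<Sum>d\<in>A - C. int (external S (insert d C)) - int (external S C))"
proof -
  let ?N = "nbh S C - C" and ?T = "\<lambda>d. S d - nbh S C - insert d C"
  have fin: "finite ?N" using assms finite_nbh by blast
  have finT: "finite (\<Union>d\<in>A - C. ?T d)" using assms by auto
  have "nbh S A - A \<subseteq> C \<union> ((?N - A) \<union> (\<Union>d\<in>A - C. ?T d))"
    by (fastforce simp: nbh_def)
  then have "external S A \<le> card (C \<union> ((?N - A) \<union> (\<Union>d\<in>A - C. ?T d)))"
    unfolding external_def using fin finT assms by (intro card_mono) auto
  also have "\<dots> \<le> card C + (card (?N - A) + card (\<Union>d\<in>A - C. ?T d))"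
    by (meson add_left_mono card_Un_le le_trans)
  also have "\<dots> \<le> card C + (card (?N - A) + (\<Sum>d\<in>A - C. card (?T d)))"
    using assms by (intro add_left_mono card_UN_le) auto
  finally have 1: "external S A \<le> card C + (card (?N - A) + (\<Sum>d\<in>A - C. card (?T d)))" .
  have "(\<Sum>d\<in>A - C. int (external S (insert d C)) - int (external S C)) =
      (\<Sum>d\<in>A - C. int (card (?T d)) - of_bool (d \<in> nbh S C))"
  proof (rule sum.cong[OF refl])
    fix d assume "d \<in> A - C"
    then have "external S (insert d C) + of_bool (d \<in> nbh S C) = external S C + card (?T d)"
      by (intro external_insert assms) auto
    then show "int (external S (insert d C)) - int (external S C) =
        int (card (?T d)) - of_bool (d \<in> nbh S C)"
      by (cases "d \<in> nbh S C") auto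
  qed
  also have "\<dots> = int (\<Sum>d\<in>A - C. card (?T d)) - (\<Sum>d\<in>A - C. of_bool (d \<in> nbh S C))"
    by (simp add: sum_subtractf)
  also have "(\<Sum>d\<in>A - C. of_bool (d \<in> nbh S C)) = int (card ({d \<in> A - C. d \<in> nbh S C}))"
    using assms by (simp add: of_bool_def sum.If_cases Int_def)
  also have "{d \<in> A - C. d \<in> nbh S C} = ?N \<inter> A" by auto
  finally have 2: "(\<Sum>d\<in>A - C. int (external S (insert d C)) - int (external S C)) =
    int (\<Sum>d\<in>A - C. card (?T d)) - int (card (?N \<inter> A))" .
  have "card (?N \<inter> A) + card (?N - A) = external S C"
    unfolding external_def using fin by (metis card_Int_Diff)
  then show ?thesis using 1 2 by linarith
qed

text \<open>The bound solves the recurrence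
  \<open>e (i + 1) = (1 - 1 / p) * e i + i / p\<close>, \<open>e 0 = external S A\<close>, which holds with \<open>\<le>\<close> for the gap to \<open>A\<close>
  as long as every step gains something.\<close>

lemma greedy_invariant:
  assumes "greedy (external S) Z C" "card C \<le> p" "A \<subseteq> Z" "card A = p" "0 < p"
    and finZ: "finite Z" and finS: "\<And>c. finite (S c)"
  shows "finite C \<and> C \<subseteq> Z \<and> (saturated S Z C \<or> external S A \<le> 2 * external S C \<or>
    card C \<le> external S C \<and>
    real (external S A) - real (external S C) \<le>
      real (card C) - real p + (1 - 1 / real p) ^ card C * (real (external S A) + real p))"
  using assms(1,2)
proof induction
  case empty
  then show ?case by simp
next
  case (step C c)
  have "card C \<le> p" using step.prems card_insert_le[of C c] by linarith
  note IH = step.IH[OF this]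
  then have fin: "finite C" "C \<subseteq> Z" by blast+
  have cC: "card (insert c C) = Suc (card C)" using step.hyps(2) fin by simp
  have finO: "finite A" using assms(3) finZ by (rule finite_subset)
  let ?f = "external S"
  let ?bound = "\<lambda>C. real (?f A) - real (?f C) \<le>
    real (card C) - real p + (1 - 1 / real p) ^ card C * (real (?f A) + real p)"
  have max: "?f (insert d C) \<le> ?f (insert c C)" if "d \<in> A - C" for d
    using step.hyps(3)[of d] that assms(3) by blast
  consider (neg) "?f (insert c C) < ?f C" | (zero) "?f (insert c C) = ?f C"
    | (pos) "?f (insert c C) > ?f C" by linarith
  then have "saturated S Z (insert c C) \<or> ?f A \<le> 2 * ?f (insert c C) \<or>
    card (insert c C) \<le> ?f (insert c C) \<and> ?bound (insert c C)"
  proof cases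
    case neg
    have "saturated S Z C"
    proof (rule saturated_if_decreasing)
      show "?f (insert d C) < ?f C" if "d \<in> Z - C" for d
        using step.hyps(3)[OF that] neg by linarith
    qed (use fin finS in auto)
    then show ?thesis by (intro disjI1 saturated_insert)
  next
    case zero
    \<comment> \<open>The best gain is 0, so no candidate of \<open>A\<close> gains anything;
      combined with \<open>card C \<le> external S C\<close> from the induction hypothesis this
      yields the factor 2.\<close>
    have "(\<Sum>d\<in>A - C. int (?f (insert d C)) - int (?f C)) \<le> 0"
      using max zero by (intro sum_nonpos) simp
    then have "?f A \<le> ?f C + card C"
      using external_le_gains[where S = S, OF fin(1) finO finS] by linarith
    then have "?f A \<le> 2 * ?f (insert c C) \<or> saturated S Z C"
      using IH zero by (elim conjE disjE) simp_all
    then show ?thesis using saturated_insert[of S Z C c] by argo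
  next
    case pos
    define g where "g = int (?f (insert c C)) - int (?f C)"
    have "(\<Sum>d\<in>A - C. int (?f (insert d C)) - int (?f C)) \<le> (\<Sum>d\<in>A - C. g)"
      unfolding g_def using max by (intro sum_mono) simp
    \<comment> \<open>At most \<open>p\<close> summands; replacing their number by \<open>p\<close>
      is sound because \<open>g\<close> is positive.\<close>
    also have "\<dots> \<le> int p * g"
      using pos card_mono[OF finO, of "A - C"] assms(4) by (simp add: g_def mult_right_mono)
    finally have "int (?f A) - int (card C) \<le> int (?f C) + int p * g"
      using external_le_gains[where S = S, OF fin(1) finO finS] by linarith
    then have "real_of_int (int (?f A) - int (card C)) \<le> real_of_int (int (?f C) + int p * g)"
      by (simp only: of_int_le_iff)
    then have "(real (?f A) - real (card C) - real (?f C)) / real p \<le> real_of_int g"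
      using \<open>0 < p\<close> by (simp add: divide_simps mult.commute)
    \<comment> \<open>One step shrinks the gap by the factor 1 - 1/p, up to the correction for the
      members of \<open>C\<close>.\<close>
    then have gain: "real (?f A) - real (?f (insert c C)) \<le>
      (real (?f A) - real (?f C)) * (1 - 1 / real p) + real (card C) / real p"
      by (simp add: g_def diff_divide_distrib add_divide_distrib algebra_simps)
    have bound: "?bound (insert c C)" if "?bound C"
    proof -
      have "(real (?f A) - real (?f C)) * (1 - 1 / real p) \<le>
        (real (card C) - real p + (1 - 1 / real p) ^ card C * (real (?f A) + real p)) * (1 - 1 / real p)"
        using that \<open>0 < p\<close> by (intro mult_right_mono) auto
      also have "\<dots> = real (card C) - real p - real (card C) / real p + 1 +
          (1 - 1 / real p) ^ Suc (card C) * (real (?f A) + real p)"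
        using \<open>0 < p\<close> by (simp add: add_divide_distrib algebra_simps)
      finally show ?thesis using gain unfolding cC of_nat_Suc by linarith
    qed
    \<comment> \<open>A positive gain is an integer, hence at least 1, which keeps pace with the
      card.\<close>
    have "card (insert c C) \<le> ?f (insert c C)" if "card C \<le> ?f C"
      using that pos cC by linarith
    moreover have "?f A \<le> 2 * ?f (insert c C)" if "?f A \<le> 2 * ?f C"
      using that pos by linarith
    ultimately show ?thesis using IH bound saturated_insert[of S Z C c] by argo
  qed
  then show ?case using fin step.hyps(2) by blast
qed

theorem greedy_approximation:
  assumes "greedy (external S) Z C" "card C = p" "A \<subseteq> Z" "card A = p"
    and "finite Z" "\<And>c. finite (S c)"
  shows "(exp 1 - 1) / (exp 1 + 1) * real (external S A) \<le> real (external S C)"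
proof (cases "p = 0")
  case True
  then have "A = {}" using assms finite_subset by fastforce
  then show ?thesis by (simp add: external_def nbh_def)
next
  case False
  let ?e = "exp (1::real)" and ?f = "\<lambda>B. real (external S B)"
  \<comment> \<open>Equivalent to e \<le> 3. With it, both an optimal and a half-optimal committee
    meet the ratio.\<close>
  have e1: "(?e - 1) / (?e + 1) \<le> 1 / 2"
    using exp_le exp_ge_zero[of "1::real"] by (simp add: divide_simps add_pos_nonneg)
  \<comment> \<open>At card \<open>p\<close> the linear terms of the invariant cancel.\<close>
  have finC: "finite C" "C \<subseteq> Z" and inv: "saturated S Z C \<or> external S A \<le> 2 * external S C \<or>
    p \<le> external S C \<and>
    ?f A - ?f C \<le> (1 - 1 / real p) ^ p * (?f A + real p)"
    using greedy_invariant[OF assms(1) _ assms(3,4), of] False assms by auto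
  from inv consider (sat) "saturated S Z C" | (half) "external S A \<le> 2 * external S C"
    | (gain) "p \<le> external S C" "?f A - ?f C \<le> (1 - 1 / real p) ^ p * (?f A + real p)"
    by blast
  then show ?thesis
  proof cases
    case sat
    then have "?f A \<le> ?f C"
      using saturated_imp_optimal[OF sat assms(3)] assms finC by auto
    moreover have "(?e - 1) / (?e + 1) * ?f A \<le> 1 * ?f A"
      using e1 by (intro mult_right_mono) linarith+
    ultimately show ?thesis by simp
  next
    case half
    have "(?e - 1) / (?e + 1) * ?f A \<le> 1 / 2 * ?f A"
      using e1 by (intro mult_right_mono) linarith+
    then show ?thesis using half by linarith
  next
    case gain
    \<comment> \<open>From 1 + x \<le> exp x at x = -1/p.\<close>
    have "(1 - 1 / real p) ^ p \<le> exp (- 1 / real p) ^ p"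
      using False exp_ge_add_one_self[of "- 1 / real p"] by (intro power_mono) auto
    also have "\<dots> = 1 / ?e"
      using False by (simp add: exp_of_nat_mult[symmetric] exp_minus divide_simps)
    finally have "(1 - 1 / real p) ^ p * (?f A + real p) \<le> 1 / ?e * (?f A + ?f C)"
      using gain(1) by (intro mult_mono) auto
    then have "?f A - ?f C \<le> (?f A + ?f C) / ?e" using gain(2) by simp
    then have "(?f A - ?f C) * ?e \<le> ?f A + ?f C" by (simp add: pos_le_divide_eq)
    \<comment> \<open>Collecting terms turns the inequality into (e - 1) OPT \<le> (e + 1)
      ext.\<close>
    then show ?thesis by (simp add: divide_simps add_pos_pos algebra_simps)
  qed
qed

section \<open>Unit-cost reasoning about programs\<close>

text \<open>One exponent is all that the cost analysis tracks: it bounds the bit length of every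
  address and operand by \<open>Suc K\<close>.\<close>

definition bounded_state :: "nat \<Rightarrow> state \<Rightarrow> bool" where
  "bounded_state K s \<longleftrightarrow> (\<forall>r. fst s r < 2 ^ K) \<and> (\<forall>a. snd s a < 2 ^ K)"

text \<open>\<open>n\<close> counts unit-cost steps (\<open>Suc k\<close> for loading the constant \<open>k\<close>). A step at most doubles the
  largest number present, so step counts alone control the bit lengths and hence the logarithmic cost.\<close>

definition run :: "prog \<Rightarrow> state \<Rightarrow> nat \<Rightarrow> state \<Rightarrow> bool" where
  "run c s n s' \<longleftrightarrow> (\<exists>t. exec c s t s' \<and>
    (\<forall>K. bounded_state K s \<longrightarrow> t \<le> 2 * n * (K + n) \<and> bounded_state (K + n) s'))"

text \<open>Total correctness with the step count visible to the postcondition, so that results and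
  running times are proved together.\<close>

definition wp :: "prog \<Rightarrow> state \<Rightarrow> (nat \<Rightarrow> state \<Rightarrow> bool) \<Rightarrow> bool" where
  "wp c s Q \<longleftrightarrow> (\<exists>n s'. run c s n s' \<and> Q n s')"

section \<open>Bit lengths and bounded states\<close>

lemma bit_length_le: "x < 2 ^ K \<Longrightarrow> bit_length x \<le> Suc K"
proof (induction K arbitrary: x)
  case 0
  then show ?case by (simp add: bit_length.simps)
next
  case (Suc K)
  then have "x div 2 < 2 ^ K" by (simp add: less_mult_imp_div_less mult.commute)
  from Suc.IH[OF this] show ?case by (subst bit_length.simps) simp
qed

lemma less_two_power_bit_length: "x < 2 ^ bit_length x"
proof (induction x rule: bit_length.induct)
  case (1 n)
  then show ?case by (subst bit_length.simps) (auto simp: not_less)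
qed

lemma bit_length_pos: "1 \<le> bit_length x"
  by (subst bit_length.simps) simp

lemma bit_length_le_Suc: "bit_length k \<le> Suc k"
  by (meson bit_length_le less_exp)

lemma less_two_power_mono: "(x::nat) < 2 ^ K \<Longrightarrow> x < 2 ^ (K + n)"
  by (meson le_add1 less_le_trans one_le_numeral power_increasing)

lemma bounded_state_mono: "bounded_state K s \<Longrightarrow> bounded_state (K + n) s"
  by (auto simp: bounded_state_def intro: less_two_power_mono)

section \<open>Step counts of the program constructs\<close>

lemma run_elementary:
  assumes "exec c (R, M) t s'"
    and "\<And>K. bounded_state K (R, M) \<Longrightarrow> t \<le> 2 * Suc K \<and> bounded_state (Suc K) s'"
  shows "run c (R, M) 1 s'"
  unfolding run_def using assms by fastforce

lemma run_Skip: "run Skip (R, M) 1 (R, M)"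
  by (rule run_elementary, rule exec.Skip) (use bounded_state_mono[of _ _ 1] in auto)

text \<open>A constant is unrelated to the numbers already present, so its size is controlled by k <
  2^k; this is why it counts as \<open>Suc k\<close> steps.\<close>

lemma run_Const: "run (Const r k) (R, M) (Suc k) (R(r := k), M)"
proof -
  have "bit_length k \<le> 2 * Suc k * (K + Suc k)" for K
  proof -
    have "Suc k * 1 \<le> Suc k * (2 * (K + Suc k))" by (intro mult_le_mono) auto
    then show ?thesis using bit_length_le_Suc[of k] by (simp add: algebra_simps)
  qed
  moreover have "k < 2 ^ (K + Suc k)" for K
    using less_exp[of k] less_two_power_mono[of k k "Suc K"] by (simp add: add.commute)
  ultimately show ?thesis
    unfolding run_def
    by (intro exI[of _ "bit_length k"] conjI exec.Const)
      (auto simp: bounded_state_def simp del: power_Suc add_Suc_right intro: less_two_power_mono)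
qed

lemma two_bit_lengths_le:
  "x < 2 ^ K \<Longrightarrow> y < 2 ^ K \<Longrightarrow> bit_length x + bit_length y \<le> 2 * Suc K"
  using bit_length_le[of x K] bit_length_le[of y K] by simp

lemma run_Add: "run (Add r a b) (R, M) 1 (R(r := R a + R b), M)"
proof (rule run_elementary, rule exec.Add)
  fix K assume K: "bounded_state K (R, M)"
  then have "R a + R b < 2 ^ K + 2 ^ K"
    by (intro add_strict_mono) (simp_all add: bounded_state_def)
  then show "bit_length (R a) + bit_length (R b) \<le> 2 * Suc K \<and>
      bounded_state (Suc K) (R(r := R a + R b), M)"
    using K two_bit_lengths_le[of "R a" K "R b"] bounded_state_mono[OF K, of 1]
    by (simp add: bounded_state_def)
qed

lemma run_Sub: "run (Sub r a b) (R, M) 1 (R(r := R a - R b), M)"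
  by (rule run_elementary, rule exec.Sub)
    (auto simp: bounded_state_def simp del: mult_Suc_right intro!: two_bit_lengths_le
      intro: less_two_power_mono[where n = 1, simplified] less_imp_diff_less)

lemma run_Load: "run (Load r a) (R, M) 1 (R(r := M (R a)), M)"
  by (rule run_elementary, rule exec.Load)
    (auto simp: bounded_state_def simp del: mult_Suc_right intro!: two_bit_lengths_le
      intro: less_two_power_mono[where n = 1, simplified])

lemma run_Store: "run (Store a b) (R, M) 1 (R, M(R a := R b))"
  by (rule run_elementary, rule exec.Store)
    (auto simp: bounded_state_def simp del: mult_Suc_right intro!: two_bit_lengths_le
      intro: less_two_power_mono[where n = 1, simplified])

text \<open>Covers sequencing (\<open>b = 0\<close>, \<open>k = 0\<close>) and loop unrolling
  (\<open>b\<close> the cost of the test, \<open>k = 1\<close>). The final exponent \<open>X\<close>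
  dominates the exponents of all phases, so each phase costs at most \<open>2 * X\<close> per step
  and the counts add up.\<close>

lemma run_compose:
  assumes "run c s n s'" "run d s' n' s''"
    and "\<And>t t'. exec c s t s' \<Longrightarrow> exec d s' t' s'' \<Longrightarrow> exec e s (b + t + t') s''"
    and "\<And>K. bounded_state K s \<Longrightarrow> b \<le> k * Suc K"
  shows "run e s (k + n + n') s''"
proof -
  obtain t where t: "exec c s t s'"
    "\<And>K. bounded_state K s \<Longrightarrow> t \<le> 2 * n * (K + n) \<and> bounded_state (K + n) s'"
    using assms(1) by (auto simp: run_def)
  obtain t' where t': "exec d s' t' s''"
    "\<And>K. bounded_state K s' \<Longrightarrow> t' \<le> 2 * n' * (K + n') \<and> bounded_state (K + n') s''"
    using assms(2) by (auto simp: run_def)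
  have "b + t + t' \<le> 2 * (k + n + n') * (K + (k + n + n')) \<and> bounded_state (K + (k + n + n')) s''"
    if K: "bounded_state K s" for K
  proof
    have b: "bounded_state (K + n) s'" using t(2)[OF K] by simp
    define X where "X = K + (k + n + n')"
    have "b \<le> 2 * k * X"
    proof (cases k)
      case (Suc j)
      then have "k * Suc K \<le> k * (2 * X)" by (intro mult_le_mono2) (simp add: X_def)
      then show ?thesis using assms(4)[OF K] by (simp add: ac_simps)
    qed (use assms(4)[OF K] in simp)
    moreover have "t \<le> 2 * n * X"
      using t(2)[OF K] mult_le_mono2[of "K + n" X "2 * n"] unfolding X_def by linarith
    moreover have "t' \<le> 2 * n' * X"
      using t'(2)[OF b] mult_le_mono2[of "K + n + n'" X "2 * n'"] unfolding X_def by linarith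
    ultimately have "b + t + t' \<le> 2 * (k + n + n') * X"
      by (simp add: distrib_right)
    then show "b + t + t' \<le> 2 * (k + n + n') * (K + (k + n + n'))" by (simp only: X_def)
    have "bounded_state (K + n + n') s''" using t'(2)[OF b] by simp
    from bounded_state_mono[OF this, of k] show "bounded_state (K + (k + n + n')) s''"
      by (simp add: ac_simps)
  qed
  then show ?thesis
    unfolding run_def using assms(3)[OF t(1) t'(1)] by blast
qed

lemma run_Seq: "run c s n s' \<Longrightarrow> run d s' n' s'' \<Longrightarrow> run (Seq c d) s (n + n') s''"
  using run_compose[of c s n s' d n' s'' "Seq c d" 0 0] by (auto intro: exec.Seq)

lemma run_test:
  assumes "run c (R, M) n s'"
    and "\<And>t. exec c (R, M) t s' \<Longrightarrow> exec e (R, M) (bit_length (R a) + t) s'"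
  shows "run e (R, M) (Suc n) s'"
proof -
  obtain t where t: "exec c (R, M) t s'"
    "\<And>K. bounded_state K (R, M) \<Longrightarrow> t \<le> 2 * n * (K + n) \<and> bounded_state (K + n) s'"
    using assms(1) by (auto simp: run_def)
  have "bit_length (R a) + t \<le> 2 * Suc n * (K + Suc n) \<and> bounded_state (K + Suc n) s'"
    if K: "bounded_state K (R, M)" for K
  proof
    have "bit_length (R a) \<le> Suc K"
      using K by (intro bit_length_le) (simp add: bounded_state_def)
    then show "bit_length (R a) + t \<le> 2 * Suc n * (K + Suc n)"
      using t(2)[OF K] by (simp add: algebra_simps)
    show "bounded_state (K + Suc n) s'"
      using t(2)[OF K] bounded_state_mono[of "K + n" s' 1] by simp
  qed
  then show ?thesis unfolding run_def using assms(2)[OF t(1)] by blast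
qed

lemma run_CondTrue: "R a \<noteq> 0 \<Longrightarrow> run c (R, M) n s' \<Longrightarrow> run (Cond a c d) (R, M) (Suc n) s'"
  by (erule run_test) (rule exec.CondTrue)

lemma run_CondFalse: "R a = 0 \<Longrightarrow> run d (R, M) n s' \<Longrightarrow> run (Cond a c d) (R, M) (Suc n) s'"
  by (erule run_test) (rule exec.CondFalse)

lemma run_WhileFalse: "R a = 0 \<Longrightarrow> run (While a c) (R, M) 1 (R, M)"
  by (rule run_elementary, erule exec.WhileFalse)
    (use bounded_state_mono[of _ _ 1] in \<open>auto simp: bit_length.simps\<close>)

lemma run_WhileTrue:
  assumes "R a \<noteq> 0" "run c (R, M) n s'" "run (While a c) s' n' s''"
  shows "run (While a c) (R, M) (Suc (n + n')) s''"
  using run_compose[OF assms(2,3), of "While a c" "bit_length (R a)" 1] assms(1)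
  by (auto intro: exec.WhileTrue bit_length_le simp: bounded_state_def)

section \<open>Proof rules for programs\<close>

lemma wp_Skip: "Q 1 (R, M) \<Longrightarrow> wp Skip (R, M) Q"
  unfolding wp_def using run_Skip by blast

lemma wp_Const: "Q (Suc k) (R(r := k), M) \<Longrightarrow> wp (Const r k) (R, M) Q"
  unfolding wp_def using run_Const by blast

lemma wp_Add: "Q 1 (R(r := R a + R b), M) \<Longrightarrow> wp (Add r a b) (R, M) Q"
  unfolding wp_def using run_Add by blast

lemma wp_Sub: "Q 1 (R(r := R a - R b), M) \<Longrightarrow> wp (Sub r a b) (R, M) Q"
  unfolding wp_def using run_Sub by blast

lemma wp_Load: "Q 1 (R(r := M (R a)), M) \<Longrightarrow> wp (Load r a) (R, M) Q"
  unfolding wp_def using run_Load by blast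

lemma wp_Store: "Q 1 (R, M(R a := R b)) \<Longrightarrow> wp (Store a b) (R, M) Q"
  unfolding wp_def using run_Store by blast

lemma wp_Seq: "wp c s (\<lambda>n s'. wp d s' (\<lambda>n' s''. Q (n + n') s'')) \<Longrightarrow> wp (Seq c d) s Q"
  unfolding wp_def using run_Seq by blast

lemma wp_Cond:
  "(R a \<noteq> 0 \<Longrightarrow> wp c (R, M) (\<lambda>n. Q (Suc n))) \<Longrightarrow> (R a = 0 \<Longrightarrow> wp d (R, M) (\<lambda>n. Q (Suc n))) \<Longrightarrow>
    wp (Cond a c d) (R, M) Q"
  unfolding wp_def by (cases "R a = 0") (blast intro: run_CondTrue run_CondFalse)+

lemma wp_WhileFalse: "R a = 0 \<Longrightarrow> Q 1 (R, M) \<Longrightarrow> wp (While a c) (R, M) Q"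
  unfolding wp_def using run_WhileFalse by blast

lemma wp_WhileTrue:
  "R a \<noteq> 0 \<Longrightarrow> wp c (R, M) (\<lambda>n s'. wp (While a c) s' (\<lambda>n'. Q (Suc (n + n')))) \<Longrightarrow>
    wp (While a c) (R, M) Q"
  unfolding wp_def using run_WhileTrue by blast

lemma wp_mono: "wp c s P \<Longrightarrow> (\<And>n s'. P n s' \<Longrightarrow> Q n s') \<Longrightarrow> wp c s Q"
  unfolding wp_def by blast

lemmas wp_straight = wp_Skip wp_Const wp_Add wp_Sub wp_Load wp_Store wp_Seq

section \<open>The greedy program\<close>

text \<open>The input \<open>w\<close> followed by a characteristic vector of \<open>C\<close>: person \<open>c\<close> is marked in cell
  \<open>c + length w\<close>.\<close>

definition marked_memory :: "nat list \<Rightarrow> nat set \<Rightarrow> nat \<Rightarrow> nat" where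
  "marked_memory w C a = (if a < length w then w ! a else of_bool (a - length w \<in> C))"

lemma marked_memory_mark:
  "(marked_memory w C)(c + length w := 1) = marked_memory w (insert c C)"
  by (rule ext) (auto simp: marked_memory_def)

lemma marked_memory_unmark:
  "c \<notin> C \<Longrightarrow> (marked_memory w (insert c C))(c + length w := 0) = marked_memory w C"
  by (rule ext) (auto simp: marked_memory_def)

lemma marked_memory_mark_cell: "marked_memory w C (c + length w) = of_bool (c \<in> C)"
  by (simp add: marked_memory_def)

text \<open>A pointer is described by the suffix \<open>drop pos w\<close> still to be read, so
  loops over the input follow list induction. Marks do not disturb the reading, as they lie behind
  the input.\<close>

lemma marked_memory_read:
  assumes "drop pos w = x # xs"
  shows "marked_memory w C pos = x"
  using assms by (metis drop_eq_Nil hd_drop_conv_nth list.distinct(1) list.sel(1) marked_memory_def not_le)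

lemma drop_Suc_tail: "drop pos w = x # xs \<Longrightarrow> drop (Suc pos) w = xs"
  by (simp add: drop_Suc drop_tl)

text \<open>Registers: 0 length of the input, 2 the constant 1, 3 number of candidates, 4 number of voters,
  5 the constant 0, 6 members still to be chosen (later: length of the output); 7, 8 counter and
  pointer of the scan of the candidates, 9 address of the mark of the current one, 10 one plus the
  best value so far (0 if there is none), 11 address of the mark attaining it; 12, 13 counter and
  pointer of the scan of the ballots, 14 mark of the current voter, 15 number of represented voters;
  16 counter of the scan of a ballot, 17 number of marks met, 18 scratch.\<close>

definition approvals_loop :: prog where
  "approvals_loop = While 16 (Seq (Load 18 13) (Seq (Add 18 18 0) (Seq (Load 18 18)
    (Seq (Add 17 17 18) (Seq (Add 13 13 2) (Sub 16 16 2))))))"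

text \<open>Register 17 starts arbitrary so that the induction goes through; only whether it
  vanishes matters later. Six instructions and a test make 7 steps per approval.\<close>

lemma wp_approvals_loop:
  assumes "drop (R 13) w = vs @ rest" "R 16 = length vs" "R 0 = length w" "R 2 = 1"
  shows "wp approvals_loop (R, marked_memory w C) (\<lambda>n s'. \<exists>R'. s' = (R', marked_memory w C) \<and>
    n \<le> 7 * length vs + 1 \<and> (R' 17 = 0 \<longleftrightarrow> R 17 = 0 \<and> set vs \<inter> C = {}) \<and>
    R' 13 = R 13 + length vs \<and> (\<forall>r < 16. r \<noteq> 13 \<longrightarrow> R' r = R r))"
  using assms
proof (induction vs arbitrary: R)
  case Nil
  then show ?case unfolding approvals_loop_def by (intro wp_WhileFalse) auto
next
  case (Cons x vs)
  note read = marked_memory_read[of "R 13" w x "vs @ rest"] drop_Suc_tail[of "R 13" w x "vs @ rest"]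
  from Cons.prems show ?case
    apply (subst approvals_loop_def)
    apply (rule wp_WhileTrue, simp)
    apply (intro wp_straight)
    apply (fold approvals_loop_def)
    apply (rule wp_mono, rule Cons.IH)
    using read by (simp_all add: marked_memory_mark_cell)
qed

section \<open>Counting the represented voters of a marked committee\<close>

definition voter_step :: prog where
  "voter_step = Seq (Load 14 13) (Seq (Add 14 14 0) (Seq (Load 14 14)
    (Seq (Add 13 13 2) (Seq (Load 16 13) (Seq (Add 13 13 2) (Seq (Const 17 0) (Seq approvals_loop
    (Seq (Cond 14 Skip (Cond 17 (Add 15 15 2) Skip)) (Sub 12 12 2)))))))))"

definition voters_loop :: prog where
  "voters_loop = While 12 voter_step"

definition encode_ballots :: "(nat \<times> nat list) list \<Rightarrow> nat list" where
  "encode_ballots bs = concat (map (\<lambda>(v, vs). v # length vs # vs) bs)"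

definition represented :: "nat set \<Rightarrow> nat \<times> nat list \<Rightarrow> bool" where
  "represented C b \<longleftrightarrow> fst b \<notin> C \<and> set (snd b) \<inter> C \<noteq> {}"

text \<open>Register 14 excludes voters who are members, and register 17 demands an approved member;
  the nested conditionals thus decide \<open>represented\<close>.\<close>

lemma wp_voter_step:
  assumes "drop (R 13) w = v # length vs # vs @ rest" "R 0 = length w" "R 2 = 1"
  shows "wp voter_step (R, marked_memory w C) (\<lambda>n s'. \<exists>R'. s' = (R', marked_memory w C) \<and>
    n \<le> 7 * length vs + 12 \<and> R' 15 = R 15 + of_bool (represented C (v, vs)) \<and>
    R' 13 = R 13 + length vs + 2 \<and> R' 12 = R 12 - 1 \<and> (\<forall>r < 12. R' r = R r))"
proof -
  note d2 = drop_Suc_tail[OF assms(1)]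
  note read = marked_memory_read[OF assms(1)] marked_memory_read[OF d2]
    drop_Suc_tail[OF d2] marked_memory_mark_cell
  show ?thesis
    unfolding voter_step_def
    apply (intro wp_straight)
    apply (rule wp_mono[OF wp_approvals_loop[where vs = vs and rest = rest]])
    apply (simp add: read assms; fail)+
    apply (elim exE conjE)
    apply hypsubst
    apply (intro wp_straight wp_Cond)
    apply (auto simp: represented_def assms read)
    done
qed

text \<open>A ballot with k names occupies k + 2 cells and costs at most 7k + 13 steps including the
  test, hence 13 steps per cell.\<close>

lemma wp_voters_loop:
  assumes "drop (R 13) w = encode_ballots bs" "R 12 = length bs" "R 0 = length w" "R 2 = 1"
  shows "wp voters_loop (R, marked_memory w C) (\<lambda>n s'. \<exists>R'. s' = (R', marked_memory w C) \<and>
    n \<le> 13 * length (encode_ballots bs) + 1 \<and>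
    R' 15 = R 15 + length (filter (represented C) bs) \<and> (\<forall>r < 12. R' r = R r))"
  using assms
proof (induction bs arbitrary: R)
  case Nil
  then show ?case unfolding voters_loop_def by (intro wp_WhileFalse) auto
next
  case (Cons b bs)
  obtain v vs where b: "b = (v, vs)" by (cases b)
  have d: "drop (R 13) w = v # length vs # vs @ encode_ballots bs"
    using Cons.prems b by (simp add: encode_ballots_def)
  have d': "drop (R 13 + length vs + 2) w = encode_ballots bs"
    using arg_cong[OF drop_Suc_tail[OF drop_Suc_tail[OF d]], of "drop (length vs)"]
    by (simp add: ac_simps)
  show ?case
    unfolding voters_loop_def
  proof (rule wp_WhileTrue, use Cons.prems in simp, rule wp_mono[OF wp_voter_step[OF d Cons.prems(3,4)]],
      elim exE conjE, hypsubst, fold voters_loop_def)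
    fix n R1
    assume n: "n \<le> 7 * length vs + 12" and R1: "R1 15 = R 15 + of_bool (represented C (v, vs))"
      "R1 13 = R 13 + length vs + 2" "R1 12 = R 12 - 1" "\<forall>r < 12. R1 r = R r"
    show "wp voters_loop (R1, marked_memory w C) (\<lambda>n' s'. \<exists>R'. s' = (R', marked_memory w C) \<and>
      Suc (n + n') \<le> 13 * length (encode_ballots (b # bs)) + 1 \<and>
      R' 15 = R 15 + length (filter (represented C) (b # bs)) \<and> (\<forall>r < 12. R' r = R r))"
    proof (rule wp_mono[OF Cons.IH])
      show "drop (R1 13) w = encode_ballots bs" using d' R1 by simp
    qed (use Cons.prems R1 n b in \<open>auto simp: encode_ballots_def\<close>)
  qed
qed

text \<open>What all scans rely on and preserve. The input has three header cells. Register 5 holds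
  0, so that \<open>Add r a 5\<close> copies a register and storing it removes a mark.\<close>

definition prepared :: "nat list \<Rightarrow> nat list \<Rightarrow> (nat \<times> nat list) list \<Rightarrow> (nat \<Rightarrow> nat) \<Rightarrow> bool" where
  "prepared w cs bs R \<longleftrightarrow> drop 3 w = cs @ encode_ballots bs \<and>
    R 0 = length w \<and> R 2 = 1 \<and> R 3 = length cs \<and> R 4 = length bs \<and> R 5 = 0"

lemma prepared_cong: "prepared w cs bs R \<Longrightarrow> (\<And>r. r < 6 \<Longrightarrow> R' r = R r) \<Longrightarrow> prepared w cs bs R'"
  by (simp add: prepared_def)

definition representation :: "(nat \<times> nat list) list \<Rightarrow> nat set \<Rightarrow> nat" where
  "representation bs C = length (filter (represented C) bs)"

definition evaluate :: prog where
  "evaluate = Seq (Const 15 0) (Seq (Const 13 3) (Seq (Add 13 13 3) (Seq (Add 12 4 5) voters_loop)))"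

lemma wp_evaluate:
  assumes "prepared w cs bs R"
  shows "wp evaluate (R, marked_memory w C) (\<lambda>n s'. \<exists>R'. s' = (R', marked_memory w C) \<and>
    n \<le> 13 * length w + 8 \<and> R' 15 = representation bs C \<and> (\<forall>r < 12. R' r = R r))"
proof -
  have d: "drop (3 + length cs) w = encode_ballots bs"
    using assms by (metis add.commute append_eq_conv_conj drop_drop prepared_def)
  then have "length (encode_ballots bs) \<le> length w"
    by (metis diff_le_self length_drop)
  then show ?thesis
    unfolding evaluate_def
    apply (intro wp_straight)
    apply (rule wp_mono[OF wp_voters_loop[where bs = bs]])
    using assms d apply (simp_all add: prepared_def representation_def)
    apply fastforce
    done
qed

definition trial :: prog where
  "trial = Seq (Store 9 2) (Seq evaluate (Store 9 5))"

text \<open>Marking and unmarking restores the memory only because \<open>c\<close> was not marked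
  before.\<close>

lemma wp_trial:
  assumes "R 9 = c + length w" "c \<notin> C" "prepared w cs bs R"
  shows "wp trial (R, marked_memory w C) (\<lambda>n s'. \<exists>R'. s' = (R', marked_memory w C) \<and>
    n \<le> 13 * length w + 10 \<and> R' 15 = representation bs (insert c C) \<and> (\<forall>r < 12. R' r = R r))"
proof -
  have regs: "R 2 = 1" "R 5 = 0" using assms(3) by (simp_all add: prepared_def)
  have "(marked_memory w C)(R 9 := R 2) = marked_memory w (insert c C)"
    using regs assms marked_memory_mark by simp
  then show ?thesis
    unfolding trial_def
    apply (intro wp_straight)
    apply (simp only:)
    apply (rule wp_mono[OF wp_evaluate[OF assms(3)]])
    apply (elim exE conjE)
    apply hypsubst
    apply (intro wp_straight)
    using regs assms apply (simp add: marked_memory_unmark)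
    done
qed

section \<open>Searching for a best candidate\<close>

definition candidate_step :: prog where
  "candidate_step = Seq (Load 9 8) (Seq (Add 9 9 0) (Seq (Load 18 9) (Seq
    (Cond 18 Skip (Seq trial (Seq (Add 15 15 2) (Seq (Sub 18 15 10)
      (Cond 18 (Seq (Add 10 15 5) (Add 11 9 5)) Skip)))))
    (Seq (Add 8 8 2) (Sub 7 7 2)))))"

text \<open>Subtraction is truncated, so register 18 ends up nonzero iff one plus the new value
  exceeds register 10. An initial 0 there lets the first eligible candidate win even with value
  0.\<close>

lemma wp_candidate_step:
  assumes d: "drop (R 8) w = c # rest" and prep: "prepared w cs bs R"
  shows "wp candidate_step (R, marked_memory w C) (\<lambda>n s'. \<exists>R'. s' = (R', marked_memory w C) \<and>
    n \<le> 13 * length w + 21 \<and> R' 8 = Suc (R 8) \<and> R' 7 = R 7 - 1 \<and> (\<forall>r < 7. R' r = R r) \<and>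
    (if c \<notin> C \<and> R 10 \<le> representation bs (insert c C)
     then R' 10 = Suc (representation bs (insert c C)) \<and> R' 11 = c + length w
     else R' 10 = R 10 \<and> R' 11 = R 11))"
proof -
  have regs: "R 0 = length w" "R 2 = 1" "R 5 = 0" using prep by (simp_all add: prepared_def)
  note read = marked_memory_read[OF d] marked_memory_mark_cell
  show ?thesis
    unfolding candidate_step_def
    apply (intro wp_straight wp_Cond)
    subgoal using regs by (simp add: read)
    apply (rule wp_mono[OF wp_trial[where c = c, OF _ _ prepared_cong[OF prep]]])
       apply (simp add: read regs; fail)
      apply (simp add: read regs; fail)
     apply (simp; fail)
    apply (elim exE conjE)
    apply hypsubst
    apply (intro wp_straight wp_Cond)
    apply (auto simp: read regs)
    done
qed

definition candidates_loop :: prog where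
  "candidates_loop = While 7 candidate_step"

text \<open>\<open>D\<close> holds the names passed between the register states \<open>R\<close> and
  \<open>R'\<close>. Being relative to \<open>R\<close>, the description lets the induction start
  from any intermediate best value.\<close>

definition scanned ::
    "nat list \<Rightarrow> (nat \<times> nat list) list \<Rightarrow> nat set \<Rightarrow> nat set \<Rightarrow> (nat \<Rightarrow> nat) \<Rightarrow> (nat \<Rightarrow> nat) \<Rightarrow> bool" where
  "scanned w bs C D R R' \<longleftrightarrow> (\<forall>r < 7. R' r = R r) \<and> R 10 \<le> R' 10 \<and>
    (\<forall>c \<in> D - C. representation bs (insert c C) < R' 10) \<and>
    (R' 10 = R 10 \<and> R' 11 = R 11 \<or>
      (\<exists>c \<in> D - C. R' 10 = Suc (representation bs (insert c C)) \<and> R' 11 = c + length w))"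

text \<open>Accepted or rejected, an eligible \<open>c\<close> has its value below
  \<open>R1 10\<close>, and register 10 never decreases afterwards.\<close>

lemma scanned_insert:
  assumes "\<forall>r < 7. R1 r = R r"
    and "if c \<notin> C \<and> R 10 \<le> representation bs (insert c C)
       then R1 10 = Suc (representation bs (insert c C)) \<and> R1 11 = c + length w
       else R1 10 = R 10 \<and> R1 11 = R 11"
    and "scanned w bs C D R1 R'"
  shows "scanned w bs C (insert c D) R R'"
proof -
  have "R 10 \<le> R' 10" "c \<notin> C \<longrightarrow> representation bs (insert c C) < R' 10"
    using assms(2,3) by (auto simp: scanned_def split: if_splits)
  moreover have "R' 10 = R 10 \<and> R' 11 = R 11 \<or>
      (\<exists>c \<in> insert c D - C. R' 10 = Suc (representation bs (insert c C)) \<and> R' 11 = c + length w)"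
    using assms(2,3) by (auto simp: scanned_def split: if_splits)
  ultimately show ?thesis using assms(1,3) by (auto simp: scanned_def)
qed

lemma wp_candidates_loop:
  assumes "drop (R 8) w = xs @ rest" "R 7 = length xs" "prepared w cs bs R"
  shows "wp candidates_loop (R, marked_memory w C) (\<lambda>n s'. \<exists>R'. s' = (R', marked_memory w C) \<and>
    n \<le> length xs * (13 * length w + 22) + 1 \<and> scanned w bs C (set xs) R R')"
  using assms
proof (induction xs arbitrary: R)
  case Nil
  then show ?case
    unfolding candidates_loop_def by (intro wp_WhileFalse) (auto simp: scanned_def)
next
  case (Cons c xs)
  from Cons.prems(1) have d: "drop (R 8) w = c # xs @ rest" by simp
  show ?case
    unfolding candidates_loop_def
  proof (rule wp_WhileTrue, use Cons.prems in simp,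
      rule wp_mono[OF wp_candidate_step[OF d Cons.prems(3)]],
      elim exE conjE, hypsubst, fold candidates_loop_def)
    fix n R1
    assume n: "n \<le> 13 * length w + 21" and R1: "R1 8 = Suc (R 8)" "R1 7 = R 7 - 1" "\<forall>r < 7. R1 r = R r"
      "if c \<notin> C \<and> R 10 \<le> representation bs (insert c C)
       then R1 10 = Suc (representation bs (insert c C)) \<and> R1 11 = c + length w
       else R1 10 = R 10 \<and> R1 11 = R 11"
    show "wp candidates_loop (R1, marked_memory w C) (\<lambda>n' s'. \<exists>R'. s' = (R', marked_memory w C) \<and>
      Suc (n + n') \<le> length (c # xs) * (13 * length w + 22) + 1 \<and> scanned w bs C (set (c # xs)) R R')"
    proof (rule wp_mono[OF Cons.IH])
      show "drop (R1 8) w = xs @ rest" using drop_Suc_tail[OF d] R1 by simp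
      show "prepared w cs bs R1" using R1(3) by (intro prepared_cong[OF Cons.prems(3)]) simp
    qed (use Cons.prems R1 n scanned_insert[OF R1(3,4)] in auto)
  qed
qed

definition select :: prog where
  "select = Seq (Const 8 3) (Seq (Add 7 3 5) (Seq (Const 10 0) (Seq candidates_loop
    (Seq (Store 11 2) (Sub 6 6 2)))))"

lemma wp_select:
  assumes prep: "prepared w cs bs R" and ne: "set cs - C \<noteq> {}"
  shows "wp select (R, marked_memory w C) (\<lambda>n s'. \<exists>R' c. s' = (R', marked_memory w (insert c C)) \<and>
    n \<le> length w * (13 * length w + 22) + 9 \<and> c \<in> set cs - C \<and>
    (\<forall>d \<in> set cs - C. representation bs (insert d C) \<le> representation bs (insert c C)) \<and>
    R' 6 = R 6 - 1 \<and> (\<forall>r < 6. R' r = R r))"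
proof -
  have d: "drop 3 w = cs @ encode_ballots bs"
    and regs: "R 2 = 1" "R 3 = length cs" "R 5 = 0"
    using prep by (simp_all add: prepared_def)
  have "length cs \<le> length w" using arg_cong[OF d, of length] by simp
  then have len: "length cs * (13 * length w + 22) \<le> length w * (13 * length w + 22)" by (rule mult_le_mono1)
  show ?thesis
    unfolding select_def
  proof (intro wp_straight, rule wp_mono[OF wp_candidates_loop[where xs = cs and cs = cs and bs = bs and rest = "encode_ballots bs"]])
    let ?R = "R(8 := 3, 7 := (R(8 := 3)) 3 + (R(8 := 3)) 5, 10 := 0)"
    show "drop (?R 8) w = cs @ encode_ballots bs" using d by simp
    show "?R 7 = length cs" using regs by simp
    show "prepared w cs bs ?R" by (rule prepared_cong[OF prep]) simp
    fix n s'
    assume "\<exists>R'. s' = (R', marked_memory w C) \<and>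
      n \<le> length cs * (13 * length w + 22) + 1 \<and> scanned w bs C (set cs) ?R R'"
    then obtain R1 where s': "s' = (R1, marked_memory w C)"
      and n: "n \<le> length cs * (13 * length w + 22) + 1"
      and sc: "scanned w bs C (set cs) ?R R1" by blast
    have n': "n \<le> length w * (13 * length w + 22) + 1" using n len by linarith
    \<comment> \<open>Some candidate is eligible and its value lies below register 10, which
      therefore left its initial 0; this selects the disjunct with a witness.\<close>
    have "R1 10 \<noteq> 0" using sc ne by (fastforce simp: scanned_def)
    then obtain c where c: "c \<in> set cs - C" "R1 10 = Suc (representation bs (insert c C))"
      "R1 11 = c + length w"
      using sc by (auto simp: scanned_def)
    have "\<forall>d \<in> set cs - C. representation bs (insert d C) \<le> representation bs (insert c C)"
      using sc c(2) by (auto simp: scanned_def less_Suc_eq_le)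
    moreover have pres: "\<forall>r < 7. R1 r = R r" using sc by (simp add: scanned_def)
    moreover have "(marked_memory w C)(R1 11 := R1 2) = marked_memory w (insert c C)"
      using c regs pres marked_memory_mark by simp
    \<comment> \<open>The leading summands are the counts of the three initialising instructions, a
      constant \<open>k\<close> counting \<open>Suc k\<close>.\<close>
    ultimately show "wp (Seq (Store 11 2) (Sub 6 6 2)) s' (\<lambda>n' s''.
      \<exists>R' c. s'' = (R', marked_memory w (insert c C)) \<and>
        Suc 3 + (1 + (Suc 0 + (n + n'))) \<le> length w * (13 * length w + 22) + 9 \<and> c \<in> set cs - C \<and>
        (\<forall>d \<in> set cs - C. representation bs (insert d C) \<le> representation bs (insert c C)) \<and>
        R' 6 = R 6 - 1 \<and> (\<forall>r < 6. R' r = R r))"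
      unfolding s' using n' c(1) regs
      by (intro wp_straight exI[of _ "R1(6 := R1 6 - R1 2)"] exI[of _ c]) auto
  qed
qed

section \<open>Building and writing the committee\<close>

definition greedy_loop :: prog where
  "greedy_loop = While 6 select"

lemma wp_greedy_loop:
  assumes "prepared w cs bs R" "R 6 = k" "greedy (representation bs) (set cs) C"
    "card C + k \<le> card (set cs)"
  shows "wp greedy_loop (R, marked_memory w C) (\<lambda>n s'. \<exists>R' C'. s' = (R', marked_memory w C') \<and>
    n \<le> k * (length w * (13 * length w + 22) + 10) + 1 \<and>
    greedy (representation bs) (set cs) C' \<and> card C' = card C + k \<and> (\<forall>r < 6. R' r = R r))"
  using assms
proof (induction k arbitrary: R C)
  case 0
  then show ?case unfolding greedy_loop_def by (intro wp_WhileFalse) auto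
next
  case (Suc k)
  have fin: "finite C" using Suc.prems(3) by (rule greedy_finite)
  \<comment> \<open>The room left by the card hypothesis guarantees that the search meets an
    unmarked candidate.\<close>
  have "\<not> set cs \<subseteq> C" using card_mono[OF fin, of "set cs"] Suc.prems(4) by auto
  then have ne: "set cs - C \<noteq> {}" by blast
  show ?case
    unfolding greedy_loop_def
  proof (rule wp_WhileTrue, use Suc.prems in simp, rule wp_mono[OF wp_select[OF Suc.prems(1) ne]],
      elim exE conjE, hypsubst, fold greedy_loop_def)
    fix n R1 c
    assume n: "n \<le> length w * (13 * length w + 22) + 9" and c: "c \<in> set cs - C"
      "\<forall>d \<in> set cs - C. representation bs (insert d C) \<le> representation bs (insert c C)"
      and R1: "R1 6 = R 6 - 1" "\<forall>r < 6. R1 r = R r"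
    have card: "card (insert c C) = Suc (card C)" using c fin by simp
    show "wp greedy_loop (R1, marked_memory w (insert c C)) (\<lambda>n' s'. \<exists>R' C'. s' = (R', marked_memory w C') \<and>
      Suc (n + n') \<le> Suc k * (length w * (13 * length w + 22) + 10) + 1 \<and>
      greedy (representation bs) (set cs) C' \<and> card C' = card C + Suc k \<and> (\<forall>r < 6. R' r = R r))"
    proof (rule wp_mono[OF Suc.IH])
      show "prepared w cs bs R1" using R1(2) by (intro prepared_cong[OF Suc.prems(1)]) simp
      show "greedy (representation bs) (set cs) (insert c C)"
        using Suc.prems(3) c by (blast intro: greedy.step)
      fix n' s'
      assume "\<exists>R' C'. s' = (R', marked_memory w C') \<and>
        n' \<le> k * (length w * (13 * length w + 22) + 10) + 1 \<and>
        greedy (representation bs) (set cs) C' \<and> card C' = card (insert c C) + k \<and> (\<forall>r < 6. R' r = R1 r)"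
      then show "\<exists>R' C'. s' = (R', marked_memory w C') \<and>
        Suc (n + n') \<le> Suc k * (length w * (13 * length w + 22) + 10) + 1 \<and>
        greedy (representation bs) (set cs) C' \<and> card C' = card C + Suc k \<and> (\<forall>r < 6. R' r = R r)"
        using n R1(2) card by (elim exE conjE) (intro exI conjI, assumption, auto)
    qed (use Suc.prems R1 card in auto)
  qed
qed

text \<open>The output overwrites the input, but the write position stays below the read position.\<close>

definition output_loop :: prog where
  "output_loop = While 7 (Seq (Load 9 8) (Seq (Add 18 9 0) (Seq (Load 18 18)
    (Seq (Cond 18 (Seq (Store 6 9) (Add 6 6 2)) Skip) (Seq (Add 8 8 2) (Sub 7 7 2))))))"

text \<open>Writing destroys the input, so the memory is arbitrary and only the unread candidates
  and the marks are assumed intact. Preservation below \<open>R 6\<close> protects, in the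
  induction, the entries already written.\<close>

lemma wp_output_loop:
  assumes "R 7 = length xs" "R 2 = 1" "R 5 = 0" "R 6 < R 8" "R 8 + length xs \<le> R 0"
    "\<And>k. k < length xs \<Longrightarrow> M (R 8 + k) = xs ! k"
    "\<And>x. x \<in> set xs \<Longrightarrow> M (x + R 0) = of_bool (x \<in> C)"
  shows "wp output_loop (R, M) (\<lambda>n s'. \<exists>R' M'. s' = (R', M') \<and>
    n \<le> 9 * length xs + 1 \<and> R' 6 = R 6 + length (filter (\<lambda>x. x \<in> C) xs) \<and> R' 5 = 0 \<and>
    (\<forall>k < length (filter (\<lambda>x. x \<in> C) xs). M' (R 6 + k) = filter (\<lambda>x. x \<in> C) xs ! k) \<and>
    (\<forall>a < R 6. M' a = M a))"
  using assms
proof (induction xs arbitrary: R M)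
  case Nil
  then show ?case unfolding output_loop_def by (intro wp_WhileFalse) auto
next
  case (Cons x xs)
  have rd: "M (R 8) = x" using Cons.prems(6)[of 0] by simp
  have mk: "M (x + R 0) = of_bool (x \<in> C)" using Cons.prems(7) by simp
  have nx: "M (Suc (R 8 + k)) = xs ! k" if "k < length xs" for k
    using Cons.prems(6)[of "Suc k"] that by simp
  \<comment> \<open>Marks start at address \<open>R 0\<close>, above the write position, so no write
    hits a mark.\<close>
  have ne: "y + R 0 \<noteq> R 6" for y using Cons.prems(4,5) by linarith
  note IH = Cons.IH[unfolded output_loop_def]
  show ?case
  proof (cases "x \<in> C")
    case True
    show ?thesis
      unfolding output_loop_def
      apply (rule wp_WhileTrue, use Cons.prems in simp)
      apply (intro wp_straight wp_Cond)
      subgoal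
        apply (rule wp_mono[OF IH])
        using Cons.prems nx ne True rd mk apply simp_all
        apply (elim exE conjE)
        apply (intro exI conjI, assumption)
        apply (auto simp: nth_Cons split: nat.split)
        done
      subgoal using True rd mk Cons.prems by simp
      done
  next
    case False
    show ?thesis
      unfolding output_loop_def
      apply (rule wp_WhileTrue, use Cons.prems in simp)
      apply (intro wp_straight wp_Cond)
      subgoal using False rd mk Cons.prems by simp
      subgoal
        apply (rule wp_mono[OF IH])
        using Cons.prems nx ne False rd mk apply (simp_all)
        apply (elim exE conjE)
        apply (intro exI conjI, assumption)
        apply auto
        done
      done
  qed
qed

text \<open>The header cells 0, 1 and 2 are read through register 5 (still 0), register 2 (just set
  to 1) and register 4. Register 0 receives the output length only at the end, since the marks are
  addressed relative to the input length.\<close>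

definition greedy_program :: prog where
  "greedy_program = Seq (Const 2 1) (Seq (Load 6 5) (Seq (Load 3 2) (Seq (Const 4 2) (Seq (Load 4 4)
    (Seq greedy_loop (Seq (Const 8 3) (Seq (Add 7 3 5) (Seq (Const 6 0) (Seq output_loop (Add 0 6 5))))))))))"

lemma wp_greedy_program:
  assumes w: "w = p # length cs # length bs # cs @ encode_ballots bs" and p: "p \<le> card (set cs)"
  shows "wp greedy_program (input_state w) (\<lambda>n s'. n \<le> 30 * (length w + 1) ^ 3 \<and>
    (\<exists>C. greedy (representation bs) (set cs) C \<and> card C = p \<and> set (output_word s') = C))"
proof -
  let ?L = "length w" and ?R0 = "(\<lambda>_. 0)(0 := length w) :: nat \<Rightarrow> nat"
  have init: "input_state w = (?R0, marked_memory w {})"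
    by (auto simp: input_state_def marked_memory_def)
  have mem: "marked_memory w {} 0 = p" "marked_memory w {} (Suc 0) = length cs" "marked_memory w {} 2 = length bs"
    by (simp_all add: marked_memory_def w)
  have L: "3 + length cs \<le> ?L" by (simp add: w)
  have pL: "p \<le> ?L" using p L card_length[of cs] by linarith
  let ?R1 = "?R0(2 := 1, 6 := p, 3 := length cs, 4 := length bs)"
  let ?out = "Seq (Const 8 3) (Seq (Add 7 3 5) (Seq (Const 6 0) (Seq output_loop (Add 0 6 5))))"
  have prep: "prepared w cs bs ?R1" by (simp add: prepared_def w)
  \<comment> \<open>The 8 reserves the steps of the five instructions before the greedy
    loop.\<close>
  let ?Q = "\<lambda>n s'. n + 8 \<le> 30 * (?L + 1) ^ 3 \<and>
    (\<exists>C. greedy (representation bs) (set cs) C \<and> card C = p \<and> set (output_word s') = C)"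
  have main: "wp (Seq greedy_loop ?out) (?R1, marked_memory w {}) ?Q"
  proof (intro wp_Seq[where c = greedy_loop], rule wp_mono[OF wp_greedy_loop[OF prep _ greedy.empty]])
    fix n s'
    assume "\<exists>R' C'. s' = (R', marked_memory w C') \<and>
      n \<le> p * (?L * (13 * ?L + 22) + 10) + 1 \<and>
      greedy (representation bs) (set cs) C' \<and> card C' = card ({} :: nat set) + p \<and> (\<forall>r < 6. R' r = ?R1 r)"
    then obtain R C where s': "s' = (R, marked_memory w C)"
      and n: "n \<le> p * (?L * (13 * ?L + 22) + 10) + 1"
      and C: "greedy (representation bs) (set cs) C" "card C = p" and R: "\<forall>r < 6. R r = ?R1 r"
      by auto
    have sub: "C \<subseteq> set cs" using C(1) by (rule greedy_subset)
    have "p * (?L * (13 * ?L + 22) + 10) \<le> ?L * (?L * (13 * ?L + 22) + 10)"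
      using pL by (rule mult_le_mono1)
    \<comment> \<open>The reserve \<open>9 * length cs + 20\<close> covers the output phase and the
      initialisation.\<close>
    then have n': "n + 9 * length cs + 20 \<le> 30 * (?L + 1) ^ 3"
      using n L by (simp add: power3_eq_cube algebra_simps)
    have read: "marked_memory w C (3 + k) = cs ! k" if "k < length cs" for k
      using that by (simp add: marked_memory_def w nth_append)
    let ?R2 = "R(8 := 3, 7 := (R(8 := 3)) 3 + (R(8 := 3)) 5, 6 := 0)"
    show "wp ?out s' (\<lambda>n' s''. n + n' + 8 \<le> 30 * (?L + 1) ^ 3 \<and>
      (\<exists>C. greedy (representation bs) (set cs) C \<and> card C = p \<and> set (output_word s'') = C))"
      unfolding s'
    proof (intro wp_straight, rule wp_mono[OF wp_output_loop[where xs = cs and C = C]])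
      fix n' s''
      assume "\<exists>R' M'. s'' = (R' :: nat \<Rightarrow> nat, M' :: nat \<Rightarrow> nat) \<and> n' \<le> 9 * length cs + 1 \<and>
        R' 6 = ?R2 6 + length (filter (\<lambda>x. x \<in> C) cs) \<and> R' 5 = 0 \<and>
        (\<forall>k < length (filter (\<lambda>x. x \<in> C) cs). M' (?R2 6 + k) = filter (\<lambda>x. x \<in> C) cs ! k) \<and>
        (\<forall>a < ?R2 6. M' a = marked_memory w C a)"
      then obtain R' M' :: "nat \<Rightarrow> nat" where s'': "s'' = (R', M')" and t: "n' \<le> 9 * length cs + 1"
        and R': "R' 6 = length (filter (\<lambda>x. x \<in> C) cs)" "R' 5 = 0"
        and M': "\<forall>k < length (filter (\<lambda>x. x \<in> C) cs). M' k = filter (\<lambda>x. x \<in> C) cs ! k"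
        by auto
      have "map M' [0..<R' 6] = filter (\<lambda>x. x \<in> C) cs"
        using R' M' by (intro nth_equalityI) auto
      then have "set (output_word (R'(0 := R' 6 + R' 5), M')) = C"
        using R' sub by (auto simp: output_word_def)
      then show "wp (Add 0 6 5) s'' (\<lambda>n'' s'''.
        n + (Suc 3 + (1 + (Suc 0 + (n' + n'')))) + 8 \<le> 30 * (?L + 1) ^ 3 \<and>
        (\<exists>C. greedy (representation bs) (set cs) C \<and> card C = p \<and> set (output_word s''') = C))"
        unfolding s'' using C n' t by (intro wp_Add) auto
    qed (use R L read in \<open>auto simp: marked_memory_mark_cell\<close>)
  qed (use p in auto)
  show ?thesis
    unfolding greedy_program_def init
    apply (intro wp_Seq[where c = "Const _ _"] wp_Seq[where c = "Load _ _"] wp_Const wp_Load)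
    apply (rule wp_mono[where P = ?Q])
    subgoal using main by (simp add: mem)
    subgoal by simp
    done
qed

section \<open>From ballots to elections, and the polynomial bound\<close>

lemma representation_eq_ext:
  assumes "valid_election E"
  shows "representation (zip (voter_list E) (vote_list E)) C = ext E C"
proof -
  let ?vs = "voter_list E" and ?bs = "zip (voter_list E) (vote_list E)"
  have len: "length (vote_list E) = length ?vs" and dist: "distinct ?vs"
    using assms by (auto simp: valid_election_def)
  have "(\<Union>c\<in>C. approvers E c) - C = (!) ?vs ` {i. i < length ?bs \<and> represented C (?bs ! i)}"
    using len by (fastforce simp: approvers_def represented_def)
  \<comment> \<open>Voter names are distinct, so counting ballots is counting voters.\<close>
  moreover have "inj_on ((!) ?vs) {i. i < length ?bs \<and> represented C (?bs ! i)}"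
    using dist len by (intro inj_on_nth) auto
  ultimately have "ext E C = card {i. i < length ?bs \<and> represented C (?bs ! i)}"
    by (simp add: ext_def card_image)
  then show ?thesis by (simp add: representation_def length_filter_conv_card)
qed

lemma ext_eq_external: "ext E = external (approvers E)"
  by (simp add: fun_eq_iff ext_def external_def nbh_def)

lemma bit_length_le_input_size: "x \<in> set w \<Longrightarrow> bit_length x \<le> input_size w"
  by (auto simp: input_size_def intro: member_le_sum_list)

lemma length_le_input_size: "length w \<le> input_size w"
proof (induction w)
  case (Cons x w)
  then show ?case using bit_length_pos[of x] by (simp add: input_size_def)
qed simp

text \<open>Each entry is below 2 to its own bit length, and every entry contributes at least one
  bit, which also bounds the length held in register 0.\<close>

lemma bounded_input_state: "bounded_state (input_size w) (input_state w)"
proof -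
  have "x < 2 ^ input_size w" if "x \<in> set w" for x
    using less_two_power_bit_length[of x] bit_length_le_input_size[OF that]
    by (meson less_le_trans one_le_numeral power_increasing)
  moreover have "length w < 2 ^ input_size w"
    using length_le_input_size[of w] less_exp[of "input_size w"] by linarith
  ultimately show ?thesis by (auto simp: bounded_state_def input_state_def)
qed

theorem theorem3:
  "\<exists>A. poly_time_approximation_algorithm ((exp 1 - 1) / (exp 1 + 1)) max_ext_representation A"
proof -
  \<comment> \<open>\<open>T\<close> is the step bound 30 (x + 1)^3; \<open>q\<close> is the cost
    bound 2n(K + n) of \<open>run\<close> with n bounded by \<open>T\<close> and K the input
    size.\<close>
  define T :: "nat poly" where "T = [:30:] * [:1, 1:] ^ 3"
  define q where "q = [:2:] * T * ([:0, 1:] + T)"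
  have "\<exists>t s. exec greedy_program (input_state (encode_election E)) t s \<and>
      t \<le> poly q (input_size (encode_election E)) \<and> set (output_word s) \<in> committees E \<and>
      (\<forall>C \<in> committees E. (exp 1 - 1) / (exp 1 + 1) * real (ext E C) \<le> real (ext E (set (output_word s))))"
    if E: "valid_election E" for E
  proof -
    define bs where "bs = zip (voter_list E) (vote_list E)"
    let ?w = "encode_election E" and ?cs = "candidate_list E"
    let ?S = "input_size ?w"
    have w: "?w = committee_size E # length ?cs # length bs # ?cs @ encode_ballots bs"
      using E by (simp add: encode_election_def encode_ballots_def bs_def valid_election_def)
    have "committee_size E \<le> card (set ?cs)"
      using E by (simp add: valid_election_def distinct_card)
    from wp_greedy_program[OF w this] obtain n s C where run: "run greedy_program (input_state ?w) n s"
      and n: "n \<le> 30 * (length ?w + 1) ^ 3" and C: "greedy (representation bs) (set ?cs) C"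
      "card C = committee_size E" "set (output_word s) = C"
      unfolding wp_def by blast
    have "(length ?w + 1) ^ 3 \<le> (?S + 1) ^ 3"
      using length_le_input_size[of ?w] by (intro power_mono) auto
    then have "n \<le> 30 * (?S + 1) ^ 3" using n by linarith
    then have nT: "n \<le> poly T ?S" by (simp add: T_def)
    from run bounded_input_state obtain t where t: "exec greedy_program (input_state ?w) t s"
      "t \<le> 2 * n * (?S + n)"
      unfolding run_def by blast
    have "2 * n * (?S + n) \<le> 2 * poly T ?S * (?S + poly T ?S)"
      using nT by (intro mult_le_mono add_left_mono) auto
    also have "\<dots> = poly q ?S" by (simp add: q_def)
    finally have "t \<le> poly q ?S" using t(2) by simp
    moreover have "C \<in> committees E"
      using C greedy_subset by (auto simp: committees_def)
    \<comment> \<open>The program is greedy for the ballot count; as functions of the committee this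
      count and \<open>external (approvers E)\<close> coincide.\<close>
    moreover have gr: "greedy (external (approvers E)) (set ?cs) C"
      using C(1) representation_eq_ext[OF E, abs_def] by (simp add: bs_def ext_eq_external[symmetric])
    have "(exp 1 - 1) / (exp 1 + 1) * real (ext E D) \<le> real (ext E C)" if "D \<in> committees E" for D
      unfolding ext_eq_external
    proof (rule greedy_approximation[OF gr])
      show "finite (approvers E c)" for c by (simp add: approvers_def)
    qed (use that C in \<open>auto simp: committees_def\<close>)
    ultimately show ?thesis using t(1) C(3) by blast
  qed
  then show ?thesis
    unfolding poly_time_approximation_algorithm_def max_ext_representation_def
    by (intro exI[of _ greedy_program] exI[of _ q]) simp
qed

end
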